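(* For every constant $C>0$ there exists a constant $c>0$ such that for infinitely many positive integers $n$ there is an $n$-vertex directed unweighted graph $G=(V,E)$ with the following property: for every shortcut set $H$ of $G$ with $|H|\le Cn$, the graph $G\cup H$ has diameter at least $c\, n^{1/4}$.
   Context: For a directed graph $G=(V,E)$, a shortcut set is a set $H$ of ordered pairs $(u,v)$ of distinct vertices such that $v$ is reachable from $u$ in $G$ (i.e. $H$ is a set of edges of the transitive closure of $G$). $G\cup H$ denotes the graph $(V,E\cup H)$. The diameter of a directed graph is $\max \mathrm{dist}(u,v)$ over all ordered pairs $(u,v)$ with $v$ reachable from $u$, where $\mathrm{dist}$ is the unweighted shortest-path distance. *)

theory Defs
  imports
    "Graph_Theory.Pair_Digraph"
    "Graph_Theory.Shortest_Path"
begin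

text \<open>
  Unweighted distance is the library's shortest-path cost with unit arc weights; it is
  \<open>\<infinity>\<close> exactly when the target is unreachable.
\<close>

definition unweighted_dist :: "'a pair_pre_digraph \<Rightarrow> 'a \<Rightarrow> 'a \<Rightarrow> ereal" where
  "unweighted_dist G u v = wf_digraph.\<mu> (with_proj G) (\<lambda>_. 1) u v"

text \<open>
  Only reachable pairs count, so for a finite nonempty digraph this is the maximum of a
  finite nonempty set (a vertex reaches itself) and is a finite number.
\<close>

definition digraph_diameter :: "'a pair_pre_digraph \<Rightarrow> ereal" where
  "digraph_diameter G =
     Max {unweighted_dist G u v | u v. u \<rightarrow>\<^sup>*\<^bsub>with_proj G\<^esub> v}"

definition shortcut_set :: "'a pair_pre_digraph \<Rightarrow> ('a \<times> 'a) set \<Rightarrow> bool" where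
  "shortcut_set G H \<longleftrightarrow> (\<forall>(u, v) \<in> H. u \<noteq> v \<and> u \<rightarrow>\<^sup>*\<^bsub>with_proj G\<^esub> v)"

definition add_shortcuts :: "'a pair_pre_digraph \<Rightarrow> ('a \<times> 'a) set \<Rightarrow> 'a pair_pre_digraph" where
  "add_shortcuts G H = G\<lparr>parcs := parcs G \<union> H\<rparr>"

end

theory Submission
  imports Defs "HOL-Library.Nat_Bijection"
begin

text \<open>
  Take \<open>L + 1\<close> layers of a planar grid. Crossing one layer performs \<open>m\<close> micro-steps, where
  micro-step \<open>k\<close> either stays or adds the vector \<open>(1, r k)\<close>, and \<open>r\<close> is bit reversal on
  \<open>{0..<N}\<close> with \<open>N = m L\<close>. The critical path of direction \<open>d\<close> takes micro-step \<open>k\<close> iff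
  \<open>r k < d\<close>; as it is the unique maximiser of \<open>(d - 1/2) x - y\<close> at each micro-step, it is
  the only path between its endpoints, even after adding shortcuts.

  A shortcut \<open>(u, v)\<close> spanning \<open>g\<close> layers can only lie on critical paths whose directions are not
  separated by any \<open>r k\<close> with \<open>k\<close> in a window of length \<open>m g\<close>. Since bit reversal is well spread
  over every window, there are at most \<open>8 L / g\<close> of them, so a shortcut saves at most \<open>8 L\<close>
  layers in total over all critical paths. There are \<open>N\<^sup>4\<close> critical paths and each of them
  needs savings \<open>L / 2\<close> before its length drops to \<open>L / 2\<close>. Hence at least \<open>N\<^sup>4 / 16\<close> shortcuts are
  needed, which exceeds \<open>C n\<close> once \<open>m > 128 C\<close>, as \<open>n \<le> 8 L N\<^sup>3\<close>; and \<open>L\<close> is of order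
  \<open>n powr (1/4)\<close> for fixed \<open>m\<close>.
\<close>

section \<open>Bit reversal and its distribution over windows\<close>

fun bit_reversal :: "nat \<Rightarrow> nat \<Rightarrow> nat" where
  "bit_reversal 0 k = 0"
| "bit_reversal (Suc q) k = 2 ^ q * (k mod 2) + bit_reversal q (k div 2)"

lemma bit_reversal_less: "bit_reversal q k < 2 ^ q"
proof (induction q arbitrary: k)
  case (Suc q)
  have "2 ^ q * (k mod 2) + bit_reversal q (k div 2) < 2 ^ q * (1::nat) + 2 ^ q"
    using Suc by (intro add_le_less_mono mult_le_mono2) simp_all
  then show ?case by simp
qed simp

text \<open>An aligned block of length \<open>2 ^ j\<close> runs through all patterns of the low
  \<open>j\<close> bits, and reversal turns these into the top \<open>j\<close> of \<open>q\<close>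
  bits. The induction removes the lowest bit of \<open>k\<close>, which is the top bit
  \<open>b\<close> of \<open>e\<close>.\<close>

lemma bit_reversal_hits_dyadic:
  assumes "j \<le> q" "e < 2 ^ j"
  shows "\<exists>k\<in>{i * 2 ^ j..<(i + 1) * 2 ^ j}. bit_reversal q k div 2 ^ (q - j) = e"
  using assms
proof (induction j arbitrary: q e)
  case 0
  then show ?case using bit_reversal_less[of q i] by auto
next
  case (Suc j)
  then obtain q' where q: "q = Suc q'" by (cases q) auto
  define b where "b = e div 2 ^ j"
  define e' where "e' = e mod 2 ^ j"
  have e: "e = 2 ^ j * b + e'" unfolding b_def e'_def by simp
  have b: "b < 2" unfolding b_def using Suc.prems(2) by (simp add: less_mult_imp_div_less)
  have "e' < 2 ^ j" unfolding e'_def by simp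
  with Suc.IH[of q' e'] Suc.prems(1) q obtain k
    where k: "i * 2 ^ j \<le> k" "k < (i + 1) * 2 ^ j"
      and rk: "bit_reversal q' k div 2 ^ (q' - j) = e'"
    by auto
  have split: "(2::nat) ^ q' = 2 ^ (q' - j) * 2 ^ j"
    using Suc.prems(1) q by (simp flip: power_add)
  have "(2 * k + b) mod 2 = b" "(2 * k + b) div 2 = k" using b by auto
  then have "bit_reversal q (2 * k + b) = 2 ^ (q' - j) * (2 ^ j * b) + bit_reversal q' k"
    using q split by (simp add: mult.assoc)
  then have "bit_reversal q (2 * k + b) div 2 ^ (q - Suc j) = e"
    using q rk e by simp
  moreover have "2 * k + b \<in> {i * 2 ^ Suc j..<(i + 1) * 2 ^ Suc j}"
  proof -
    have "2 * k + b < 2 * ((i + 1) * 2 ^ j)" using k(2) b by linarith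
    moreover have "2 * (i * 2 ^ j) \<le> 2 * k + b" using k(1) by linarith
    ultimately show ?thesis by (simp add: algebra_simps)
  qed
  ultimately show ?case by blast
qed

text \<open>A window of length \<open>w\<close> contains an aligned block of length
  \<open>2 ^ j\<close> with \<open>w < 2 ^ (j + 2)\<close>, and an interval of length
  \<open>2 * M\<close> contains an aligned block of length \<open>M = 2 ^ (q - j)\<close>. By
  \<open>bit_reversal_hits_dyadic\<close> the former attains a value in the latter, so
  \<open>d' - d\<close> stays below \<open>2 * M\<close>.\<close>

lemma bit_reversal_window_gap:
  assumes w: "2 \<le> w" "w \<le> 2 ^ q" and d: "d \<le> d'" "d' < 2 ^ q"
    and gap: "\<And>k. k \<in> {lo..<lo + w} \<Longrightarrow> \<not> (d \<le> bit_reversal q k \<and> bit_reversal q k < d')"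
  shows "(d' - d + 1) * w \<le> 8 * 2 ^ q"
proof -
  obtain i where i: "2 ^ i \<le> w" "w < 2 ^ Suc i"
    using ex_power_ivl1[of 2 w] w by auto
  \<comment> \<open>One exponent less leaves room for alignment: a window that starts anywhere must
    still contain a full aligned block.\<close>
  with w obtain j where j: "i = Suc j" by (cases i) auto
  have "(2::nat) ^ i \<le> 2 ^ q" using i w by linarith
  then have "i \<le> q" by simp
  then have jq: "j \<le> q" using j by simp
  define M :: nat where "M = 2 ^ (q - j)"
  have M: "M > 0" "M * 2 ^ j = 2 ^ q" unfolding M_def using jq by (simp_all flip: power_add)
  have "d' < d + 2 * M"
  proof (rule ccontr)
    assume "\<not> d' < d + 2 * M"
    then have d': "d + 2 * M \<le> d'" by simp
    \<comment> \<open>\<open>e\<close> indexes the first block of length \<open>M\<close> that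
      starts after \<open>d\<close>; below, \<open>s\<close> does the same for \<open>lo\<close> and
      length \<open>2 ^ j\<close>.\<close>
    define e where "e = d div M + 1"
    have dM: "d div M * M \<le> d" "d < d div M * M + M"
      using M(1) by (simp_all add: dividend_less_div_times add.commute)
    have eM: "e * M = d div M * M + M" unfolding e_def by simp
    then have "e * M < M * 2 ^ j" unfolding M(2) using dM(1) d d' M(1) by linarith
    then have "e < 2 ^ j" by (subst (asm) mult.commute) simp
    define s where "s = lo div 2 ^ j + 1"
    have lo: "lo div 2 ^ j * 2 ^ j \<le> lo" "lo < lo div 2 ^ j * 2 ^ j + 2 ^ j"
      by (simp_all add: dividend_less_div_times add.commute)
    obtain k where k: "s * 2 ^ j \<le> k" "k < (s + 1) * 2 ^ j" and rk: "bit_reversal q k div M = e"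
      using bit_reversal_hits_dyadic[OF jq \<open>e < 2 ^ j\<close>, of s] unfolding M_def by auto
    have s: "s * 2 ^ j = lo div 2 ^ j * 2 ^ j + 2 ^ j" "(s + 1) * 2 ^ j = s * 2 ^ j + 2 ^ j"
      unfolding s_def by simp_all
    have "lo \<le> k" using k(1) lo(2) s by linarith
    moreover have "k < lo + w" using k(2) lo(1) i(1) s unfolding j power_Suc by linarith
    moreover have "e * M \<le> bit_reversal q k" "bit_reversal q k < e * M + M"
      using rk M(1) by (auto simp: dividend_less_div_times add.commute)
    then have "d \<le> bit_reversal q k" "bit_reversal q k < d'"
      using dM d' eM by linarith+
    ultimately show False using gap[of k] by simp
  qed
  then have "(d' - d + 1) * w \<le> (2 * M) * 2 ^ (j + 2)"
    using i j d by (intro mult_le_mono) auto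
  also have "\<dots> = 8 * 2 ^ q" using M(2) by (simp add: algebra_simps)
  finally show ?thesis .
qed

section \<open>Threshold sets are determined by their size and sum\<close>

lemma subset_adjacent_intervals:
  fixes p :: nat
  assumes "p \<le> q" "q \<le> s" "A \<subseteq> {p..<q}" "B \<subseteq> {q..<s}"
  shows "A \<union> B \<subseteq> {p..<s}" "A \<inter> B = {}" "finite A" "finite B" "A = (A \<union> B) \<inter> {p..<q}"
proof -
  have "{p..<s} = {p..<q} \<union> {q..<s}" "{p..<q} \<inter> {q..<s} = {}" using assms by auto
  then show "A \<union> B \<subseteq> {p..<s}" "A \<inter> B = {}" "A = (A \<union> B) \<inter> {p..<q}"
    using assms by blast+
  show "finite A" "finite B" using assms finite_subset finite_atLeastLessThan by blast+
qed

lemma threshold_subset_unique: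
  fixes r :: "nat \<Rightarrow> nat"
  assumes fin: "finite I" and AI: "A \<subseteq> I"
    and card: "card A = card {k\<in>I. r k < d}" and sum: "sum r A = sum r {k\<in>I. r k < d}"
  shows "A = {k\<in>I. r k < d}"
proof -
  let ?D = "{k\<in>I. r k < d}"
  \<comment> \<open>the threshold set is the smallest maximiser of the sum of \<open>f\<close>\<close>
  define f where "f k = int d - int (r k)" for k
  have fA: "finite A" and fD: "finite ?D" using fin AI finite_subset by auto
  have "sum f A = int (card A) * int d - int (sum r A)"
    unfolding f_def by (simp add: sum_subtractf)
  also have "\<dots> = sum f ?D"
    unfolding f_def card sum by (simp add: sum_subtractf)
  finally have "sum f A = sum f ?D" .
  moreover have "sum f A = sum f (A \<inter> ?D) + sum f (A - ?D)"
    using sum.Int_Diff[OF fA] .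
  moreover have "sum f ?D = sum f (A \<inter> ?D) + sum f (?D - A)"
    using sum.Int_Diff[OF fD, of f A] by (simp add: Int_commute)
  moreover have "sum f (A - ?D) \<le> 0"
    using AI unfolding f_def by (intro sum_nonpos) auto
  ultimately have le: "sum f (?D - A) \<le> 0" by linarith
  have "?D - A = {}"
  proof (rule ccontr)
    assume "?D - A \<noteq> {}"
    then have "sum f (?D - A) > 0" using fD unfolding f_def by (intro sum_pos) auto
    with le show False by simp
  qed
  then have "?D \<subseteq> A" by blast
  then show ?thesis using card_subset_eq[OF fA, of ?D] card by simp
qed

section \<open>Layers and positions coded as natural numbers\<close>

definition vtx :: "nat \<Rightarrow> nat \<Rightarrow> nat \<Rightarrow> nat" where
  "vtx t x y = prod_encode (t, prod_encode (x, y))"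

definition lay :: "nat \<Rightarrow> nat" where "lay v = fst (prod_decode v)"
definition xpos :: "nat \<Rightarrow> nat" where "xpos v = fst (prod_decode (snd (prod_decode v)))"
definition ypos :: "nat \<Rightarrow> nat" where "ypos v = snd (prod_decode (snd (prod_decode v)))"

lemma vtx_simps [simp]:
  "lay (vtx t x y) = t" "xpos (vtx t x y) = x" "ypos (vtx t x y) = y"
  "vtx (lay v) (xpos v) (ypos v) = v"
  by (simp_all add: vtx_def lay_def xpos_def ypos_def)

lemma vtx_inject [simp]: "vtx t x y = vtx t' x' y' \<longleftrightarrow> t = t' \<and> x = x' \<and> y = y'"
  by (simp add: vtx_def)

lemma vtx_eqI: "lay u = lay v \<Longrightarrow> xpos u = xpos v \<Longrightarrow> ypos u = ypos v \<Longrightarrow> u = v"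
  by (metis vtx_simps(4))

lemma reachable_in_pverts:
  "u \<rightarrow>\<^sup>*\<^bsub>with_proj G\<^esub> v \<Longrightarrow> u \<in> pverts G \<and> v \<in> pverts G"
  unfolding reachable_def by (auto dest: in_rtrancl_on_in_F)

section \<open>Micro-steps, routes and their uniqueness\<close>

locale layered_grid =
  fixes a b :: nat
  assumes b_pos: "b > 0"
begin

abbreviation L :: nat where "L \<equiv> 2 ^ a"
abbreviation m :: nat where "m \<equiv> 2 ^ b"
abbreviation N :: nat where "N \<equiv> 2 ^ (a + b)"
abbreviation r :: "nat \<Rightarrow> nat" where "r \<equiv> bit_reversal (a + b)"

lemma m_mult_L: "m * L = N"
  by (simp add: power_add)

text \<open>\<open>A\<close> is the set of micro-steps at which the vector is added. The bounds of
  the grid are ignored; being reflexive and transitive, the relation contains reachability in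
  \<open>grid\<close> and hence every shortcut.\<close>

definition moves :: "nat \<Rightarrow> nat \<Rightarrow> bool" where
  "moves u v \<longleftrightarrow> lay u \<le> lay v \<and>
     (\<exists>A\<subseteq>{m * lay u..<m * lay v}. xpos v = xpos u + card A \<and> ypos v = ypos u + sum r A)"

lemma moves_refl: "moves u u"
  unfolding moves_def by auto

lemma moves_trans:
  assumes "moves u v" "moves v w"
  shows "moves u w"
proof -
  obtain A where A: "A \<subseteq> {m * lay u..<m * lay v}" "xpos v = xpos u + card A" "ypos v = ypos u + sum r A"
    using assms unfolding moves_def by blast
  obtain B where B: "B \<subseteq> {m * lay v..<m * lay w}" "xpos w = xpos v + card B" "ypos w = ypos v + sum r B"
    using assms unfolding moves_def by blast
  have le: "lay u \<le> lay v" "lay v \<le> lay w" using assms unfolding moves_def by auto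
  have m: "m * lay u \<le> m * lay v" "m * lay v \<le> m * lay w" using le by simp_all
  note AB = subset_adjacent_intervals[OF m A(1) B(1)]
  have "xpos w = xpos u + card (A \<union> B)" "ypos w = ypos u + sum r (A \<union> B)"
    using A B AB by (simp_all add: card_Un_disjoint sum.union_disjoint)
  with AB(1) show ?thesis using le unfolding moves_def by (meson order_trans)
qed

lemma moves_lay_less:
  assumes "moves u v" "u \<noteq> v"
  shows "lay u < lay v"
proof (rule ccontr)
  obtain A where A: "lay u \<le> lay v" "A \<subseteq> {m * lay u..<m * lay v}"
      "xpos v = xpos u + card A" "ypos v = ypos u + sum r A"
    using assms(1) unfolding moves_def by blast
  assume "\<not> lay u < lay v"
  with A(1) have lay: "lay u = lay v" by simp
  have "A = {}" using A(2) unfolding lay by simp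
  then have "xpos u = xpos v" "ypos u = ypos v" using A(3,4) by simp_all
  with lay have "u = v" by (rule vtx_eqI)
  with assms(2) show False ..
qed

definition steps :: "nat \<Rightarrow> nat \<Rightarrow> nat \<Rightarrow> nat set" where
  "steps d s t = {k\<in>{m * s..<m * t}. r k < d}"

lemma finite_steps [simp]: "finite (steps d s t)"
  unfolding steps_def by simp

text \<open>The triple consists of a direction and a start position in layer 0.\<close>

definition route :: "nat \<times> nat \<times> nat \<Rightarrow> nat \<Rightarrow> nat" where
  "route = (\<lambda>(d, x, y) t. vtx t (x + card (steps d 0 t)) (y + sum r (steps d 0 t)))"

lemma lay_route [simp]: "lay (route c t) = t"
  unfolding route_def by (simp split: prod.split)

lemma route_zero: "xpos (route (d, x, y) 0) = x" "ypos (route (d, x, y) 0) = y"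
  by (simp_all add: route_def steps_def)

lemma steps_split:
  assumes "s \<le> t"
  shows "steps d 0 t = steps d 0 s \<union> steps d s t" "steps d 0 s \<inter> steps d s t = {}"
proof -
  have "{m * 0..<m * t} = {m * 0..<m * s} \<union> {m * s..<m * t}"
    using assms by (intro ivl_disj_un_two(3)[symmetric]) simp_all
  then show "steps d 0 t = steps d 0 s \<union> steps d s t" "steps d 0 s \<inter> steps d s t = {}"
    unfolding steps_def by auto
qed

lemma route_diff:
  assumes "s \<le> t"
  shows "xpos (route (d, x, y) t) = xpos (route (d, x, y) s) + card (steps d s t)"
    and "ypos (route (d, x, y) t) = ypos (route (d, x, y) s) + sum r (steps d s t)"
  unfolding route_def using steps_split[OF assms, of d]
  by (simp_all add: card_Un_disjoint sum.union_disjoint)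

lemma moves_route:
  assumes "s \<le> t"
  shows "moves (route c s) (route c t)"
proof -
  obtain d x y where c: "c = (d, x, y)" by (cases c)
  have "steps d s t \<subseteq> {m * s..<m * t}" unfolding steps_def by blast
  with assms show ?thesis
    unfolding moves_def lay_route c
    by (intro conjI exI[of _ "steps d s t"] route_diff)
qed

text \<open>The micro-steps taken before and after \<open>v\<close> together have the size and sum
  of the threshold set of \<open>c\<close>, so they are that set by
  \<open>threshold_subset_unique\<close>. Restricting to the layers before \<open>v\<close> recovers
  the position of \<open>v\<close>.\<close>

lemma moves_between_on_route:
  assumes "moves (route c 0) v" "moves v (route c L)"
  shows "v = route c (lay v)"
proof -
  obtain d x y where c: "c = (d, x, y)" by (cases c)
  obtain A where A: "A \<subseteq> {0..<m * lay v}" "xpos v = x + card A" "ypos v = y + sum r A"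
    using assms(1) unfolding moves_def lay_route c route_zero by auto
  obtain B where B: "B \<subseteq> {m * lay v..<m * L}" "xpos (route c L) = xpos v + card B"
      "ypos (route c L) = ypos v + sum r B"
    using assms(2) unfolding moves_def lay_route by blast
  have le: "lay v \<le> L" using assms(2) unfolding moves_def by simp
  then have mle: "m * lay v \<le> m * L" by simp
  note AB = subset_adjacent_intervals[OF le0 mle A(1) B(1)]
  have D: "steps d 0 L = {k\<in>{0..<m * L}. r k < d}" unfolding steps_def by simp
  have U: "A \<union> B = {k\<in>{0..<m * L}. r k < d}"
  proof (rule threshold_subset_unique)
    show "A \<union> B \<subseteq> {0..<m * L}" by (rule AB(1))
    show "card (A \<union> B) = card {k\<in>{0..<m * L}. r k < d}"
      using A B AB(2-4) unfolding D[symmetric] by (simp add: card_Un_disjoint c route_def)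
    show "sum r (A \<union> B) = sum r {k\<in>{0..<m * L}. r k < d}"
      using A B AB(2-4) unfolding D[symmetric] by (simp add: sum.union_disjoint c route_def)
  qed simp
  have trim: "{k\<in>{0..<q}. r k < d} \<inter> {0..<p} = {k\<in>{0..<p}. r k < d}" if "p \<le> q" for p q :: nat
    using that by auto
  have "A = {k\<in>{0..<m * lay v}. r k < d}"
    using AB(5) unfolding U trim[OF mle] .
  then have "A = steps d 0 (lay v)" by (simp add: steps_def)
  then show ?thesis using A by - (rule vtx_eqI, simp_all add: c route_def)
qed

section \<open>Counting the critical paths through a shortcut\<close>

definition critical :: "(nat \<times> nat \<times> nat) set" where
  "critical = {..<N} \<times> {..<N} \<times> {..<N ^ 2}"

lemma card_critical: "card critical = N ^ 4"
  unfolding critical_def by (simp add: card_cartesian_product eval_nat_numeral)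

definition through :: "nat \<times> nat \<Rightarrow> nat \<times> nat \<times> nat \<Rightarrow> bool" where
  "through e c \<longleftrightarrow> fst e = route c (lay (fst e)) \<and> snd e = route c (lay (snd e))"

abbreviation span :: "nat \<times> nat \<Rightarrow> nat" where
  "span e \<equiv> lay (snd e) - lay (fst e)"

text \<open>Both routes have the same displacement between the ends of \<open>e\<close>, so their
  threshold sets on this window agree in size and sum.\<close>

lemma steps_eq_if_through:
  assumes "through e (d, x, y)" "through e (d', x', y')" "lay (fst e) \<le> lay (snd e)"
  shows "steps d (lay (fst e)) (lay (snd e)) = steps d' (lay (fst e)) (lay (snd e))"
proof -
  let ?s = "lay (fst e)" and ?t = "lay (snd e)"
  have eq: "xpos (snd e) = xpos (fst e) + card (steps d ?s ?t)"
       "ypos (snd e) = ypos (fst e) + sum r (steps d ?s ?t)"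
    using route_diff[OF assms(3), of d x y] assms(1) unfolding through_def by auto
  have eq': "xpos (snd e) = xpos (fst e) + card (steps d' ?s ?t)"
       "ypos (snd e) = ypos (fst e) + sum r (steps d' ?s ?t)"
    using route_diff[OF assms(3), of d' x' y'] assms(2) unfolding through_def by auto
  have "steps d ?s ?t = {k\<in>{m * ?s..<m * ?t}. r k < d'}"
    using eq eq' by (intro threshold_subset_unique) (auto simp: steps_def)
  then show ?thesis by (simp add: steps_def)
qed

text \<open>The critical paths through \<open>e\<close> are told apart by their directions. The
  smallest and the largest direction take the same micro-steps between the ends of \<open>e\<close>,
  so no \<open>r k\<close> of this window separates them and \<open>bit_reversal_window_gap\<close>
  applies.\<close>

lemma card_through_mult_span:
  assumes less: "lay (fst e) < lay (snd e)" and le: "lay (snd e) \<le> L"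
  shows "card {c\<in>critical. through e c} * span e \<le> 8 * L"
proof (cases "{c\<in>critical. through e c} = {}")
  case True
  then show ?thesis by (metis card.empty mult_0 zero_le)
next
  case False
  let ?P = "{c\<in>critical. through e c}"
  have "finite critical" unfolding critical_def by simp
  then have finP: "finite ?P" by simp
  \<comment> \<open>A direction and one vertex of the route determine its start.\<close>
  have "inj_on fst ?P"
  proof (rule inj_onI)
    fix c c' assume "c \<in> ?P" "c' \<in> ?P" and "fst c = fst c'"
    then have "route c (lay (fst e)) = route c' (lay (fst e))"
      unfolding through_def by auto
    then show "c = c'" using \<open>fst c = fst c'\<close>
      unfolding route_def by (auto split: prod.splits)
  qed
  then have card: "card ?P = card (fst ` ?P)" by (simp add: card_image)
  let ?S = "fst ` ?P"
  have finS: "finite ?S" "?S \<noteq> {}" using finP False by auto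
  let ?d = "Min ?S" and ?d' = "Max ?S"
  have "?d \<in> ?S" "?d' \<in> ?S" using finS by (auto intro: Min_in Max_in)
  then obtain x y x' y' where P: "(?d, x, y) \<in> ?P" "(?d', x', y') \<in> ?P" by auto
  have st: "steps ?d (lay (fst e)) (lay (snd e)) = steps ?d' (lay (fst e)) (lay (snd e))"
    using P less by (intro steps_eq_if_through) auto
  have dd: "?d \<le> ?d'" using finS \<open>?d' \<in> ?S\<close> by (intro Min_le) auto
  have dN: "?d' < N" using P unfolding critical_def by auto
  have win: "m * lay (fst e) + m * span e = m * lay (snd e)"
    using less by (simp flip: distrib_left)
  have "(?d' - ?d + 1) * (m * span e) \<le> 8 * N"
  proof (rule bit_reversal_window_gap[OF _ _ dd dN])
    \<comment> \<open>\<open>b > 0\<close> guarantees that even a span of one layer gives a window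
      of length at least 2.\<close>
    have "(2::nat) ^ 1 \<le> m" using b_pos by (intro power_increasing) auto
    then have "2 * 1 \<le> m * span e" using less by (intro mult_le_mono) auto
    then show "2 \<le> m * span e" by simp
    have "m * span e \<le> m * L" using le by (intro mult_le_mono2) linarith
    then show "m * span e \<le> N" by (simp only: m_mult_L)
    fix k assume k: "k \<in> {m * lay (fst e)..<m * lay (fst e) + m * span e}"
    show "\<not> (?d \<le> r k \<and> r k < ?d')"
    proof
      assume "?d \<le> r k \<and> r k < ?d'"
      then have "k \<in> steps ?d' (lay (fst e)) (lay (snd e))" "k \<notin> steps ?d (lay (fst e)) (lay (snd e))"
        using k unfolding win steps_def by auto
      with st show False by simp
    qed
  qed
  moreover have "card ?S \<le> ?d' - ?d + 1"
  proof -
    have "?S \<subseteq> {?d..?d'}"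
      using Min_le[OF finS(1)] Max_ge[OF finS(1)] by (meson atLeastAtMost_iff subsetI)
    then have "card ?S \<le> card {?d..?d'}" by (intro card_mono) auto
    then show ?thesis using dd by simp
  qed
  ultimately have "card ?S * (m * span e) \<le> 8 * N"
    by (meson mult_le_mono1 order_trans)
  then have "m * (card ?P * span e) \<le> m * (8 * L)"
    unfolding card m_mult_L[symmetric] by (simp only: ac_simps)
  then show ?thesis by simp
qed

text \<open>Double counting of pairs of a critical path and a shortcut on it, weighted by span: each
  path receives at least \<open>L / 2\<close>, each shortcut gives at most
  \<open>8 * L\<close>.\<close>

lemma critical_le_shortcuts:
  assumes fin: "finite H"
    and H: "\<And>e. e \<in> H \<Longrightarrow> lay (fst e) < lay (snd e) \<and> lay (snd e) \<le> L"
    and short: "\<And>c. c \<in> critical \<Longrightarrow> L \<le> 2 * (\<Sum>e\<in>{e\<in>H. through e c}. span e)"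
  shows "N ^ 4 \<le> 16 * card H"
proof -
  have finc: "finite critical" unfolding critical_def by simp
  have "N ^ 4 * L = (\<Sum>c\<in>critical. L)" by (simp add: card_critical)
  also have "\<dots> \<le> (\<Sum>c\<in>critical. 2 * (\<Sum>e\<in>{e\<in>H. through e c}. span e))"
    by (intro sum_mono short)
  also have "\<dots> = 2 * (\<Sum>e\<in>H. \<Sum>c\<in>{c\<in>critical. through e c}. span e)"
    unfolding sum_distrib_left[symmetric] using sum.swap_restrict[OF finc fin, of "\<lambda>_. span"] by simp
  also have "\<dots> \<le> 2 * (\<Sum>e\<in>H. 8 * L)"
    using card_through_mult_span H by (intro mult_le_mono2 sum_mono) simp
  also have "\<dots> = (16 * card H) * L" by simp
  finally show ?thesis by (simp only: mult_le_cancel2) simp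
qed

section \<open>The grid digraph\<close>

text \<open>One arc performs all \<open>m\<close> micro-steps of a layer at once; positions inside a
  layer crossing are not vertices. This keeps the vertex count at order \<open>L * N ^ 3\<close>, a
  factor of order \<open>m\<close> below the number \<open>N ^ 4\<close> of critical paths.\<close>

definition grid :: "nat pair_pre_digraph" where
  "grid = (let V = {v. lay v \<le> L \<and> xpos v < 2 * N \<and> ypos v < 2 * N ^ 2} in
     \<lparr>pverts = V, parcs = {(u, v). u \<in> V \<and> v \<in> V \<and> moves u v \<and> lay v = Suc (lay u)}\<rparr>)"

lemma grid_simps:
  "pverts grid = {v. lay v \<le> L \<and> xpos v < 2 * N \<and> ypos v < 2 * N ^ 2}"
  "(u, v) \<in> parcs grid \<longleftrightarrow>
     u \<in> pverts grid \<and> v \<in> pverts grid \<and> moves u v \<and> lay v = Suc (lay u)"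
  by (auto simp: grid_def Let_def)

lemma parcs_gridD:
  assumes "e \<in> parcs grid"
  shows "fst e \<in> pverts grid" "snd e \<in> pverts grid" "moves (fst e) (snd e)"
    "lay (snd e) = Suc (lay (fst e))"
  using assms grid_simps(2)[of "fst e" "snd e"] by simp_all

lemma pverts_grid_eq_image:
  "pverts grid = (\<lambda>(t, x, y). vtx t x y) ` ({..L} \<times> {..<2 * N} \<times> {..<2 * N ^ 2})"
proof -
  have "v \<in> (\<lambda>(t, x, y). vtx t x y) ` ({..L} \<times> {..<2 * N} \<times> {..<2 * N ^ 2})"
    if "v \<in> pverts grid" for v
    using that unfolding grid_simps
    by (intro image_eqI[of _ _ "(lay v, xpos v, ypos v)"]) auto
  then show ?thesis by (auto simp: grid_simps)
qed

lemma finite_pverts_grid: "finite (pverts grid)"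
  unfolding pverts_grid_eq_image by simp

lemma card_pverts_grid: "card (pverts grid) = (L + 1) * (4 * N ^ 3)"
proof -
  have "inj_on (\<lambda>(t, x, y). vtx t x y) ({..L} \<times> {..<2 * N} \<times> {..<2 * N ^ 2})"
    by (auto simp: inj_on_def)
  then show ?thesis
    unfolding pverts_grid_eq_image
    by (simp add: card_image card_cartesian_product power2_eq_square power3_eq_cube)
qed

lemma pair_digraph_grid: "pair_digraph grid"
proof
  show "finite (pverts grid)" by (fact finite_pverts_grid)
  have "parcs grid \<subseteq> pverts grid \<times> pverts grid" by (auto simp: grid_simps)
  then show "finite (parcs grid)" by (rule finite_subset) (simp add: finite_pverts_grid)
next
  fix e assume e: "e \<in> parcs grid"
  then show "fst e \<in> pverts grid" "snd e \<in> pverts grid" by (rule parcs_gridD)+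
  show "fst e \<noteq> snd e" using parcs_gridD(4)[OF e] by (metis n_not_Suc_n)
qed

lemma moves_if_reachable:
  assumes "u \<rightarrow>\<^sup>*\<^bsub>with_proj grid\<^esub> v"
  shows "moves u v"
  using assms unfolding reachable_def with_proj_simps
proof (induction rule: rtrancl_on_induct)
  case (step v w)
  then show ?case using moves_trans[of u v w] by (simp add: grid_simps(2))
qed (rule moves_refl)

text \<open>A route adds at most \<open>N\<close> to the first coordinate and \<open>N ^ 2\<close>
  to the second, which is why the box of \<open>grid\<close> is twice as wide as the range of starts
  in \<open>critical\<close>.\<close>

lemma route_in_grid:
  assumes "c \<in> critical" "t \<le> L"
  shows "route c t \<in> pverts grid"
proof -
  obtain d x y where c: "c = (d, x, y)" and x: "x < N" "y < N ^ 2"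
    using assms(1) unfolding critical_def by auto
  have mt: "m * t \<le> N" using mult_le_mono2[OF assms(2), of m] by (simp only: m_mult_L)
  have "card (steps d 0 t) \<le> card {0..<m * t}"
    unfolding steps_def by (intro card_mono) auto
  then have card: "card (steps d 0 t) \<le> N" using mt by (simp only: card_atLeastLessThan)
  have "sum r (steps d 0 t) \<le> (\<Sum>k\<in>steps d 0 t. N)"
    using bit_reversal_less by (intro sum_mono) (simp add: less_imp_le)
  also have "\<dots> \<le> N ^ 2"
    using mult_le_mono1[OF card, of N] by (simp only: sum_constant power2_eq_square of_nat_id)
  finally have "y + sum r (steps d 0 t) < 2 * N ^ 2" using x by linarith
  moreover have "x + card (steps d 0 t) < 2 * N" using x card by linarith
  ultimately show ?thesis using assms(2) by (simp add: grid_simps c route_def)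
qed

lemma route_reachable:
  assumes "c \<in> critical" "t \<le> L"
  shows "route c 0 \<rightarrow>\<^sup>*\<^bsub>with_proj grid\<^esub> route c t"
  using assms(2)
proof (induction t)
  case 0
  then show ?case using route_in_grid[OF assms(1)] by (simp add: reachable_def)
next
  case (Suc t)
  have "(route c t, route c (Suc t)) \<in> parcs grid"
    using Suc.prems route_in_grid[OF assms(1)] moves_route[of t "Suc t" c]
    by (simp add: grid_simps(2))
  then show ?case
    using Suc route_in_grid[OF assms(1), of "Suc t"]
    unfolding reachable_def by (auto intro: rtrancl_on_into_rtrancl_on)
qed

section \<open>Walks that use shortcuts\<close>

text \<open>Consecutive arcs share a vertex, so their layer intervals leave no gap. A cover indexed
  by \<open>set p\<close> counts a repeated arc once, which fits the later sum over
  \<open>H\<close>.\<close>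

lemma pcas_covers_layers:
  "pcas u p v \<Longrightarrow> {lay u..<lay v} \<subseteq> (\<Union>e\<in>set p. {lay (fst e)..<lay (snd e)})"
proof (induction u p v rule: pcas.induct)
  case (2 u e p v)
  have "{lay u..<lay v} \<subseteq> {lay u..<lay (snd e)} \<union> {lay (snd e)..<lay v}" by auto
  moreover have "fst e = u" "{lay (snd e)..<lay v} \<subseteq> (\<Union>e\<in>set p. {lay (fst e)..<lay (snd e)})"
    using 2 by simp_all
  ultimately show ?case by (simp only: list.set UN_insert) blast
qed simp

text \<open>Puts both ends of every arc between the ends of the walk, as
  \<open>moves_between_on_route\<close> requires.\<close>

lemma pcas_moves:
  assumes "pcas u p v" "\<And>e. e \<in> set p \<Longrightarrow> moves (fst e) (snd e)"
  shows "moves u v" and "e \<in> set p \<Longrightarrow> moves u (fst e) \<and> moves (snd e) v"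
proof -
  have "moves u v \<and> (\<forall>e\<in>set p. moves u (fst e) \<and> moves (snd e) v)"
    using assms
  proof (induction u p v rule: pcas.induct)
    case (2 u e p v)
    then have IH: "moves (snd e) v" "\<forall>e'\<in>set p. moves (snd e) (fst e') \<and> moves (snd e') v"
      by auto
    have e: "moves u (snd e)" "fst e = u" using 2 by auto
    show ?case using e IH moves_trans[OF e(1)] moves_refl by simp
  qed (simp add: moves_refl)
  then show "moves u v" and "e \<in> set p \<Longrightarrow> moves u (fst e) \<and> moves (snd e) v" by auto
qed

text \<open>By uniqueness the walk never leaves the route, so each shortcut it uses is one of those
  through \<open>c\<close>. The arcs must cover \<open>L\<close> layers, and those outside
  \<open>H\<close> cover one layer each.\<close>

lemma walk_length_lower_bound:
  assumes fin: "finite H" and H: "\<And>e. e \<in> H \<Longrightarrow> moves (fst e) (snd e)"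
    and p: "pcas (route c 0) p (route c L)" "set p \<subseteq> parcs grid \<union> H"
  shows "L \<le> length p + (\<Sum>e\<in>{e\<in>H. through e c}. span e)"
proof -
  have mv: "moves (fst e) (snd e)" if "e \<in> set p" for e
    using that p(2) H parcs_gridD(3) by blast
  have th: "through e c" if e: "e \<in> set p" for e
  proof -
    note ends = pcas_moves(2)[OF p(1) mv e]
    show ?thesis unfolding through_def
      using ends mv[OF e] by (meson moves_between_on_route moves_trans)
  qed
  \<comment> \<open>A grid arc that also lies in \<open>H\<close> is charged as a shortcut, so that
    \<open>set p\<close> splits disjointly.\<close>
  let ?U = "set p - H" and ?W = "{e\<in>H. through e c}"
  have "L = card {lay (route c 0)..<lay (route c L)}" by simp
  also have "\<dots> \<le> card (\<Union>e\<in>set p. {lay (fst e)..<lay (snd e)})"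
    by (intro card_mono pcas_covers_layers[OF p(1)]) auto
  also have "\<dots> \<le> (\<Sum>e\<in>set p. card {lay (fst e)..<lay (snd e)})"
    by (intro card_UN_le) simp
  also have "\<dots> = (\<Sum>e\<in>?U. span e) + (\<Sum>e\<in>set p \<inter> H. span e)"
    by (simp add: sum.Int_Diff[of "set p" _ H])
  also have "\<dots> \<le> (\<Sum>e\<in>?U. 1) + (\<Sum>e\<in>?W. span e)"
  proof (intro add_mono sum_mono)
    fix e assume "e \<in> ?U"
    then show "span e \<le> 1" using p(2) parcs_gridD(4)[of e] by auto
  next
    show "(\<Sum>e\<in>set p \<inter> H. span e) \<le> (\<Sum>e\<in>?W. span e)"
      using fin th by (intro sum_mono2) auto
  qed
  also have "(\<Sum>e\<in>?U. 1) \<le> length p"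
  proof -
    have "card ?U \<le> card (set p)" by (intro card_mono) auto
    then show ?thesis using card_length[of p] by simp
  qed
  finally show ?thesis by simp
qed

text \<open>With so few shortcuts, \<open>critical_le_shortcuts\<close> leaves a critical path whose
  shortcuts span less than \<open>L / 2\<close> layers in total; its two ends are still at distance
  at least \<open>L / 2\<close>.\<close>

lemma diameter_lower_bound:
  assumes H: "shortcut_set grid H" and few: "16 * card H < N ^ 4"
  shows "ereal (L / 2) \<le> digraph_diameter (add_shortcuts grid H)"
proof -
  let ?G = "add_shortcuts grid H"
  have H': "e \<in> H \<Longrightarrow> fst e \<noteq> snd e \<and> fst e \<rightarrow>\<^sup>*\<^bsub>with_proj grid\<^esub> snd e" for e
    using H unfolding shortcut_set_def by (cases e) auto
  have HV: "fst e \<in> pverts grid" "snd e \<in> pverts grid" if "e \<in> H" for e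
    using H'[OF that] reachable_in_pverts[of grid "fst e" "snd e"] by simp_all
  have "H \<subseteq> pverts grid \<times> pverts grid" using HV by (auto simp: mem_Times_iff)
  then have finH: "finite H" by (rule finite_subset) (simp add: finite_pverts_grid)
  have moves: "moves (fst e) (snd e)" if "e \<in> H" for e
    using H'[OF that] moves_if_reachable by blast
  have sp: "lay (fst e) < lay (snd e) \<and> lay (snd e) \<le> L" if "e \<in> H" for e
    using H'[OF that] moves[OF that] moves_lay_less HV(2)[OF that] by (auto simp: grid_simps)
  obtain c where c: "c \<in> critical" and long: "2 * (\<Sum>e\<in>{e\<in>H. through e c}. span e) < L"
    using critical_le_shortcuts[OF finH sp] few by (meson not_le)
  have parcs: "pverts ?G = pverts grid" "parcs ?G = parcs grid \<union> H"
    by (simp_all add: add_shortcuts_def)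
  have wf: "wf_digraph (with_proj ?G)"
    unfolding wf_digraph_wp_iff pair_wf_digraph_def parcs using HV parcs_gridD(1,2) by blast
  let ?u = "route c 0" and ?v = "route c L"
  have "ereal (L / 2) \<le> unweighted_dist ?G ?u ?v"
    unfolding unweighted_dist_def wf_digraph.\<mu>_def[OF wf]
  proof (rule INF_greatest)
    fix p assume "p \<in> {p. pre_digraph.awalk (with_proj ?G) ?u p ?v}"
    then have "pcas ?u p ?v" "set p \<subseteq> parcs grid \<union> H"
      unfolding pre_digraph.awalk_def by (simp_all add: parcs cas_with_proj_eq)
    then have "L \<le> length p + (\<Sum>e\<in>{e\<in>H. through e c}. span e)"
      using walk_length_lower_bound[OF finH moves] by blast
    then have "L \<le> 2 * length p" using long by linarith
    then have "real L \<le> real (2 * length p)" by (simp only: of_nat_le_iff)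
    moreover have "wf_digraph.awalk_cost (\<lambda>_. 1) p = real (length p)"
      unfolding wf_digraph.awalk_cost_def[OF wf] by (simp add: sum_list_triv)
    ultimately show "ereal (L / 2) \<le> ereal (wf_digraph.awalk_cost (\<lambda>_. 1) p)" by simp
  qed
  also have "\<dots> \<le> digraph_diameter ?G"
    unfolding digraph_diameter_def
  proof (rule Max_ge)
    let ?D = "{unweighted_dist ?G u v |u v. u \<rightarrow>\<^sup>*\<^bsub>with_proj ?G\<^esub> v}"
    let ?R = "{(u, v). u \<rightarrow>\<^sup>*\<^bsub>with_proj ?G\<^esub> v}"
    have "?R \<subseteq> pverts ?G \<times> pverts ?G" by (auto dest: reachable_in_pverts)
    then have "finite ?R" by (rule finite_subset) (simp add: parcs finite_pverts_grid)
    moreover have "?D = (\<lambda>(u, v). unweighted_dist ?G u v) ` ?R" by auto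
    ultimately show "finite ?D" by simp
    \<comment> \<open>Adding arcs keeps the pair reachable, so its distance enters the
      maximum.\<close>
    have "(?u, ?v) \<in> rtrancl_on (pverts grid) (parcs grid)"
      using route_reachable[OF c, of L] by (simp add: reachable_def)
    then have "(?u, ?v) \<in> rtrancl_on (pverts grid) (parcs grid \<union> H)"
      by (induction rule: rtrancl_on.induct) (auto intro: rtrancl_on.intros)
    then have "?u \<rightarrow>\<^sup>*\<^bsub>with_proj ?G\<^esub> ?v" by (simp add: reachable_def parcs)
    then show "unweighted_dist ?G ?u ?v \<in> ?D" by blast
  qed
  finally show ?thesis .
qed

section \<open>Numerical bounds on vertices and shortcuts\<close>

text \<open>Bounds the fourth root of the vertex count by \<open>2 * m * L\<close>. Replacing
  \<open>L\<close> by \<open>N\<close> costs a factor \<open>m\<close>, harmless because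
  \<open>m\<close> stays fixed.\<close>

lemma card_pverts_grid_le: "card (pverts grid) \<le> (2 * m * L) ^ 4"
proof -
  have "card (pverts grid) \<le> (2 * L) * (4 * N ^ 3)"
    unfolding card_pverts_grid by (intro mult_le_mono1) simp
  also have "\<dots> \<le> (2 * N) * (8 * N ^ 3)"
    by (intro mult_le_mono) simp_all
  also have "\<dots> = (2 * m * L) ^ 4"
    unfolding m_mult_L mult.assoc by (simp only: power_mult_distrib) (simp add: power4_eq_xxxx power3_eq_cube)
  finally show ?thesis .
qed

text \<open>Here \<open>128 = 8 * 16\<close>: the grid has at most \<open>8 * L * N ^ 3\<close>
  vertices, \<open>critical_le_shortcuts\<close> carries the factor 16, and
  \<open>m * L = N\<close>.\<close>

lemma few_shortcuts:
  assumes C: "128 * C < real m" and h: "real h \<le> C * real (card (pverts grid))"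
  shows "16 * h < N ^ 4"
proof -
  have "card (pverts grid) \<le> (2 * L) * (4 * N ^ 3)"
    unfolding card_pverts_grid by (intro mult_le_mono1) simp
  then have "real (card (pverts grid)) \<le> real ((2 * L) * (4 * N ^ 3))" by (simp only: of_nat_le_iff)
  then have n: "real (card (pverts grid)) \<le> 8 * L * real N ^ 3" by simp
  have pos: "0 < card (pverts grid)"
    unfolding card_pverts_grid by (intro mult_pos_pos add_pos_pos) simp_all
  have "128 * real h \<le> 128 * C * real (card (pverts grid))" using h by simp
  also have "\<dots> < real m * real (card (pverts grid))"
    using C pos by (intro mult_strict_right_mono) simp_all
  also have "\<dots> \<le> real m * (8 * L * real N ^ 3)"
    using n by (intro mult_left_mono) auto
  also have "\<dots> = 8 * real (m * L) * real N ^ 3" by simp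
  also have "\<dots> = 8 * real N ^ 4" unfolding m_mult_L by (simp add: eval_nat_numeral)
  finally have "16 * real h < real N ^ 4" by simp
  then have "real (16 * h) < real (N ^ 4)" by simp
  then show ?thesis by (simp only: of_nat_less_iff)
qed

end

section \<open>Choice of parameters\<close>

lemma power_4_powr:
  fixes x :: real
  assumes "x > 0"
  shows "(x ^ 4) powr (1/4) = x"
proof -
  have "x ^ 4 = x powr 4" using assms by simp
  then show ?thesis using assms by (simp only: powr_powr) simp
qed

theorem theorem1p1:
  shows "\<forall>C::real. C > 0 \<longrightarrow>
    (\<exists>c::real. c > 0 \<and>
      infinite {n::nat. n > 0 \<and>
        (\<exists>G :: nat pair_pre_digraph.
          pair_digraph G \<and> card (pverts G) = n \<and>
          (\<forall>H. shortcut_set G H \<and> real (card H) \<le> C * real n \<longrightarrow>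
             digraph_diameter (add_shortcuts G H) \<ge> ereal (c * real n powr (1/4))))})"
proof (intro allI impI)
  fix C :: real assume "C > 0"
  obtain b0 where b0: "128 * C < 2 ^ b0" using real_arch_pow[of 2 "128 * C"] by auto
  \<comment> \<open>\<open>b\<close> depends on \<open>C\<close> alone; the successor ensures
    \<open>b > 0\<close>.\<close>
  define b where "b = Suc b0"
  have "(2::real) ^ b0 \<le> 2 ^ b" unfolding b_def by simp
  then have b: "128 * C < 2 ^ b" using b0 by linarith
  \<comment> \<open>The quotient of the diameter bound \<open>L / 2\<close> and the bound
    \<open>2 * m * L\<close> on the fourth root of \<open>n\<close>.\<close>
  define c :: real where "c = 1 / (4 * 2 ^ b)"
  let ?good = "\<lambda>n G. pair_digraph G \<and> card (pverts G) = n \<and>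
    (\<forall>H. shortcut_set G H \<and> real (card H) \<le> C * real n \<longrightarrow>
       digraph_diameter (add_shortcuts G H) \<ge> ereal (c * real n powr (1/4)))"
  \<comment> \<open>With \<open>b\<close> fixed, the parameter \<open>a\<close> doubles as the bound
    that \<open>n\<close> has to exceed, so letting it grow gives infinitely many sizes.\<close>
  have "\<exists>n>a. n > 0 \<and> (\<exists>G :: nat pair_pre_digraph. ?good n G)" for a
  proof -
    interpret layered_grid a b by unfold_locales (simp add: b_def)
    let ?n = "card (pverts grid)"
    have "a < 2 ^ a" by (rule less_exp)
    also have "(2::nat) ^ a * 1 \<le> (2 ^ a + 1) * (4 * N ^ 3)"
      by (intro mult_le_mono) (simp_all add: Suc_le_eq)
    then have "(2::nat) ^ a \<le> (2 ^ a + 1) * (4 * N ^ 3)" by simp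
    finally have "a < ?n" by (simp only: card_pverts_grid)
    have "real ?n \<le> real (2 * m * L) ^ 4"
      using card_pverts_grid_le unfolding of_nat_power[symmetric] of_nat_le_iff .
    then have "real ?n powr (1/4) \<le> (real (2 * m * L) ^ 4) powr (1/4)"
      by (intro powr_mono2) simp_all
    also have "\<dots> = real (2 * m * L)"
      by (rule power_4_powr) simp
    finally have "c * real ?n powr (1/4) \<le> c * real (2 * m * L)"
      by (intro mult_left_mono) (simp_all add: c_def)
    also have "\<dots> = L / 2" by (simp add: c_def)
    finally have cn: "ereal (c * real ?n powr (1/4)) \<le> ereal (L / 2)" by simp
    have C: "128 * C < real m" using b by simp
    have "?good ?n grid"
      using pair_digraph_grid order_trans[OF cn diameter_lower_bound] few_shortcuts[OF C] by blast
    with \<open>a < ?n\<close> show ?thesis by (intro exI[of _ ?n] conjI exI[of _ grid]) auto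
  qed
  then have "infinite {n. n > 0 \<and> (\<exists>G :: nat pair_pre_digraph. ?good n G)}"
    unfolding infinite_nat_iff_unbounded by blast
  moreover have "c > 0" by (simp add: c_def)
  ultimately show "\<exists>c>0. infinite {n. n > 0 \<and> (\<exists>G :: nat pair_pre_digraph.
      pair_digraph G \<and> card (pverts G) = n \<and>
      (\<forall>H. shortcut_set G H \<and> real (card H) \<le> C * real n \<longrightarrow>
         digraph_diameter (add_shortcuts G H) \<ge> ereal (c * real n powr (1/4))))}" by blast
qed

end
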